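(* Let $d\ge 2$ be an integer and let $0<\alpha<1$. Let $\mu$ be an $f$-regular Radon measure on $\mathsf{T}_d$ for some function $f:\mathbb{R}_+^d\to\mathbb{R}_+$, and let $\rho>0$, $0<\vartheta<1$ be two constants such that for any double sequence $a(N,n)$ of complex numbers ($N\in\mathbb{N}$, $1\le n\le N$) with $\max_{n=1,\ldots,N}|a(N,n)|\le N^{o(1)}$ as $N\to\infty$ one has $$\int_{\mathsf{T}_d}\left|\sum_{n=1}^N a(N,n)\,\mathbf{e}(x_1n+\ldots+x_dn^d)\right|^{\rho}d\mu(\mathbf{x})\le N^{\vartheta\rho+o(1)},\qquad N\to\infty.$$ Let $\mathbf{a}=(a_n)_{n=1}^\infty$ be a complex sequence with $a_n=n^{o(1)}$. Then $$\dim(\mathcal{E}_{\mathbf{a},d,\alpha}\cap\operatorname{spt}\mu)\le \mathfrak{u}_{\rho,\vartheta}(f;d,\alpha),$$ where $$\mathfrak{u}_{\rho,\vartheta}(f;d,\alpha)=\inf\Bigl\{t>0:\ \exists\,\varepsilon>0 \text{ such that } \sum_{i=1}^\infty N_i^{\rho\vartheta-\rho\alpha+s(k)+t(\alpha-k-2)+c(d)\varepsilon}f(\boldsymbol{\zeta}_i(\varepsilon))^{-1}<\infty \text{ for some } k=0,\ldots,d-1\Bigr\}.$$ Here $c(d)$ is a positive constant which depends only on $d$, $N_i=2^i$ for $i\in\mathbb{N}$, and $\boldsymbol{\zeta}_i(\varepsilon)=(\zeta_{i,1}(\varepsilon),\ldots,\zeta_{i,d}(\varepsilon))$ with $\zeta_{i,j}(\varepsilon)=N_i^{\alpha-j-1-\varepsilon}$,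 $j=1,\ldots,d$.
   Context: $\mathsf{T}_d=(\mathbb{R}/\mathbb{Z})^d$ is the unit torus, identified with $[0,1)^d$; a Radon measure $\mu$ on $\mathsf{T}_d$ is a (nonnegative) Borel measure with $\mu(\mathsf{T}_d)<\infty$, regarded also as a measure on $\mathbb{R}^d$. $\operatorname{spt}\mu$ is the smallest closed set whose complement has $\mu$-measure zero. $\mathbb{R}_+=(0,\infty)$. Write $\mathbf{e}(x)=\exp(2\pi i x)$ and $s(k)=k(k+1)/2$. $\dim$ is Hausdorff dimension. For $\mathbf{x}\in\mathbb{R}^d$ and $\boldsymbol{\zeta}=(\zeta_1,\ldots,\zeta_d)\in\mathbb{R}_+^d$ let $\mathcal{R}(\mathbf{x},\boldsymbol{\zeta})=[x_1-\zeta_1,x_1+\zeta_1)\times\ldots\times[x_d-\zeta_d,x_d+\zeta_d)$. A Radon measure $\mu$ is $f$-regular, for a function $f:\mathbb{R}_+^d\to\mathbb{R}_+$, if for every $\boldsymbol{\zeta}\in\mathbb{R}_+^d$ one has $\mu(\mathcal{R}(\mathbf{x},\boldsymbol{\zeta}))\ge f(\boldsymbol{\zeta})$ for all $\mathbf{x}\in\operatorname{spt}\mu$. For a complex sequence $\mathbf{a}=(a_n)$, $S_{\mathbf{a},d}(\mathbf{x};N)=\sum_{n=1}^N a_n\,\mathbf{e}(x_1n+\ldots+x_dn^d)$ and $\mathcal{E}_{\mathbf{a},d,\alpha}=\{\mathbf{x}\in\mathsf{T}_d: |S_{\mathbf{a},d}(\mathbf{x};N)|\ge N^{\alpha}\text{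 for infinitely many }N\in\mathbb{N}\}$. $U=V^{o(1)}$ means that for every $\varepsilon>0$, $|U|\le V^{\varepsilon}$ once $V$ is large enough; $A(N)\le N^{c+o(1)}$ means that for every $\varepsilon>0$, $A(N)\le N^{c+\varepsilon}$ for all sufficiently large $N$. *)

theory Defs
  imports "HOL-Analysis.Analysis"
begin

section \<open>Hausdorff dimension\<close>

definition hausdorff_content :: "real \<Rightarrow> real \<Rightarrow> 'a::metric_space set \<Rightarrow> ennreal" where
  "hausdorff_content \<delta> s A =
     (INF U \<in> {U :: nat \<Rightarrow> 'a set. (\<forall>i. bounded (U i) \<and> diameter (U i) \<le> \<delta>) \<and> A \<subseteq> (\<Union>i. U i)}.
        \<Sum>i. ennreal (diameter (U i) powr s))"

definition hausdorff_measure :: "real \<Rightarrow> 'a::metric_space set \<Rightarrow> ennreal" where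
  "hausdorff_measure s A = (SUP \<delta> \<in> {0<..}. hausdorff_content \<delta> s A)"

text \<open>Only exponents \<open>s > 0\<close> are used, so no convention for \<open>0\<close> to the power \<open>0\<close> is involved;
  the empty set gets dimension \<open>0\<close>.\<close>

definition hausdorff_dim :: "'a::metric_space set \<Rightarrow> ennreal" where
  "hausdorff_dim A = Inf (ennreal ` {s. s > 0 \<and> hausdorff_measure s A = 0})"


section \<open>Measures on the torus\<close>

text \<open>Vectors with \<open>d\<close> coordinates are elements of \<open>real ^ 'd\<close> for a finite, linearly ordered
  index type of cardinality \<open>d\<close>; \<open>coord_no\<close> is the order isomorphism from \<open>'d\<close> onto
  \<open>{1, \<dots>, d}\<close>, so that \<open>x $ j\<close> is the coordinate of \<open>x\<close> with number \<open>coord_no j\<close>.\<close>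

definition coord_no :: "'d::{finite,linorder} \<Rightarrow> nat" where
  "coord_no j = card {..j}"

definition torus :: "(real ^ 'd) set" where
  "torus = {x. \<forall>j. 0 \<le> x $ j \<and> x $ j < 1}"

text \<open>A Radon measure on the torus is represented by its extension by zero to a finite Borel measure
  on the whole space; supports and rectangles are those of the whole space.\<close>

definition torus_radon_measure :: "(real ^ 'd) measure \<Rightarrow> bool" where
  "torus_radon_measure \<mu> \<longleftrightarrow> sets \<mu> = sets borel \<and> finite_measure \<mu> \<and> emeasure \<mu> (- torus) = 0"

definition spt :: "'a::topological_space measure \<Rightarrow> 'a set" where
  "spt \<mu> = \<Inter>{C. closed C \<and> emeasure \<mu> (- C) = 0}"

definition rect :: "real ^ 'd \<Rightarrow> real ^ 'd \<Rightarrow> (real ^ 'd) set" where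
  "rect x \<zeta> = {y. \<forall>j. x $ j - \<zeta> $ j \<le> y $ j \<and> y $ j < x $ j + \<zeta> $ j}"

definition pos_vecs :: "(real ^ 'd) set" where
  "pos_vecs = {\<zeta>. \<forall>j. 0 < \<zeta> $ j}"

definition regular_measure :: "(real ^ 'd \<Rightarrow> real) \<Rightarrow> (real ^ 'd) measure \<Rightarrow> bool" where
  "regular_measure f \<mu> \<longleftrightarrow> (\<forall>\<zeta>\<in>pos_vecs. \<forall>x\<in>spt \<mu>. f \<zeta> \<le> measure \<mu> (rect x \<zeta>))"


section \<open>Weyl sums\<close>

definition expi :: "real \<Rightarrow> complex" where
  "expi x = exp (2 * of_real pi * \<i> * of_real x)"

definition weyl_sum :: "(nat \<Rightarrow> complex) \<Rightarrow> real ^ 'd::{finite,linorder} \<Rightarrow> nat \<Rightarrow> complex" where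
  "weyl_sum a x N = (\<Sum>n=1..N. a n * expi (\<Sum>j\<in>UNIV. x $ j * real n ^ coord_no j))"

definition large_sums :: "(nat \<Rightarrow> complex) \<Rightarrow> real \<Rightarrow> (real ^ 'd::{finite,linorder}) set" where
  "large_sums a \<alpha> = {x \<in> torus. infinite {N. norm (weyl_sum a x N) \<ge> real N powr \<alpha>}}"

text \<open>\<open>a n = n\<^sup>o\<^sup>(\<^sup>1\<^sup>)\<close>\<close>

definition subpolynomial :: "(nat \<Rightarrow> complex) \<Rightarrow> bool" where
  "subpolynomial a \<longleftrightarrow> (\<forall>\<epsilon>>0. \<forall>\<^sub>F n in sequentially. norm (a n) \<le> real n powr \<epsilon>)"

text \<open>\<open>max\<^bsub>1\<le>n\<le>N\<^esub> |a(N,n)| \<le> N\<^sup>o\<^sup>(\<^sup>1\<^sup>)\<close>\<close>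

definition subpolynomial2 :: "(nat \<Rightarrow> nat \<Rightarrow> complex) \<Rightarrow> bool" where
  "subpolynomial2 a \<longleftrightarrow>
     (\<forall>\<epsilon>>0. \<forall>\<^sub>F N in sequentially. \<forall>n\<in>{1..N}. norm (a N n) \<le> real N powr \<epsilon>)"

text \<open>For a finite Borel measure the integrand is bounded and measurable, so the Bochner integral is
  the actual integral.\<close>

definition mean_value_bound ::
  "(real ^ 'd::{finite,linorder}) measure \<Rightarrow> real \<Rightarrow> real \<Rightarrow> bool" where
  "mean_value_bound \<mu> \<rho> \<theta> \<longleftrightarrow>
     (\<forall>a. subpolynomial2 a \<longrightarrow>
        (\<forall>\<epsilon>>0. \<forall>\<^sub>F N in sequentially.
           (LINT x:torus|\<mu>. norm (weyl_sum (a N) x N) powr \<rho>) \<le> real N powr (\<theta> * \<rho> + \<epsilon>)))"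


section \<open>The dimension bound\<close>

definition tri :: "nat \<Rightarrow> real" where
  "tri k = real k * (real k + 1) / 2"

definition zeta_vec :: "real \<Rightarrow> real \<Rightarrow> nat \<Rightarrow> real ^ 'd::{finite,linorder}" where
  "zeta_vec \<alpha> \<epsilon> i = (\<chi> j. (2 ^ i) powr (\<alpha> - real (coord_no j) - 1 - \<epsilon>))"

text \<open>The infimum is taken in the extended nonnegative reals, so it is \<open>\<infinity>\<close> if no \<open>t\<close> qualifies. The
  parameter \<open>c\<close> is the constant \<open>c(d)\<close>. The series has positive terms (for positive \<open>f\<close>), so
  its being finite is summability.\<close>

definition dim_bound ::
  "real \<Rightarrow> real \<Rightarrow> real \<Rightarrow> (real ^ 'd::{finite,linorder} \<Rightarrow> real) \<Rightarrow> real \<Rightarrow> ennreal" where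
  "dim_bound c \<rho> \<theta> f \<alpha> = Inf (ennreal ` {t. t > 0 \<and>
     (\<exists>\<epsilon>>0. \<exists>k\<in>{0..CARD('d) - 1}.
        (\<lambda>i. (2 ^ i) powr (\<rho> * \<theta> - \<rho> * \<alpha> + tri k + t * (\<alpha> - real k - 2) + c * \<epsilon>)
               * inverse (f (zeta_vec \<alpha> \<epsilon> i))) summable_on {1::nat..})})"

end

theory Submission
  imports Defs
begin

text \<open>Split the sums of length at most \<open>2\<^sup>i\<close> into dyadic blocks; if a partial sum at \<open>x\<close> is large, then
  up to a factor \<open>i + 1\<close> so is the sum over some block. A block sum is dominated, in the mean of order
  \<open>\<rho>\<close>, by the signed sums over the whole range \<open>{1..2\<^sup>i}\<close>, averaged over all choices of one sign per
  block, and the mean value hypothesis is uniform in the coefficients. Hence the set where some block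
  sum is large has measure at most \<open>N\<^sub>i\<close> to the power \<open>\<rho>(\<theta> - \<alpha>) + o(1)\<close>. Block sums vary little on the
  rectangles with half sides \<open>zeta_vec \<alpha> \<epsilon> i\<close>, so a maximal disjoint family of such rectangles centred
  at bad points of the support is controlled by regularity of \<open>\<mu>\<close>. Doubling these rectangles and
  cutting them into cubes with the \<open>(k+1)\<close>-st side length gives the cover; \<open>c = 1\<close> suffices because
  the losses can be made small in terms of \<open>\<rho>\<close>.\<close>

section \<open>Covers and Hausdorff measure\<close>

text \<open>The covers come as finite families indexed by the scale, while the content asks for one
  sequence of sets. Listing each family, padding with \<open>{}\<close> and decoding pairs by
  \<open>prod_decode\<close> gives such a sequence; the padding has diameter \<open>0\<close> and
  adds nothing to the sum.\<close>

lemma hausdorff_content_le: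
  assumes cover: "A \<subseteq> (\<Union>i. \<Union>(\<U> i))"
    and fin: "\<And>i. finite (\<U> i)"
    and small: "\<And>i U. U \<in> \<U> i \<Longrightarrow> bounded U \<and> diameter U \<le> r i"
    and card: "\<And>i. real (card (\<U> i)) \<le> b i"
    and r: "\<And>i. 0 \<le> r i" "\<And>i. r i \<le> \<delta>" and "0 < s"
  shows "hausdorff_content \<delta> s A \<le> (\<Sum>i. ennreal (b i * r i powr s))"
proof -
  have "\<exists>e. bij_betw e {..<card (\<U> i)} (\<U> i)" for i
    using ex_bij_betw_nat_finite[OF fin[of i]] by (simp add: atLeast0LessThan)
  then obtain e where e: "\<And>i. bij_betw (e i) {..<card (\<U> i)} (\<U> i)" by metis
  define V where "V = (\<lambda>(i, m). if m < card (\<U> i) then e i m else {})"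
  have V_small: "bounded (V p) \<and> diameter (V p) \<le> r (fst p)" for p
    using small[of "e (fst p) (snd p)" "fst p"] bij_betwE[OF e[of "fst p"]] r(1)[of "fst p"]
    by (auto simp: V_def split: prod.splits)
  have "U \<subseteq> (\<Union>p. V p)" if "U \<in> \<U> i" for i U
  proof -
    have "U \<in> e i ` {..<card (\<U> i)}" using that e[of i] by (simp add: bij_betw_def)
    then obtain m where "m < card (\<U> i)" "U = e i m" by auto
    then have "U = V (i, m)" by (simp add: V_def)
    then show ?thesis by blast
  qed
  then have "(\<Union>i. \<Union>(\<U> i)) \<subseteq> (\<Union>p. V p)" by (intro UN_least Union_least)
  with cover have "A \<subseteq> (\<Union>p. V p)" by (rule order_trans)
  also have "\<dots> \<subseteq> (\<Union>n. V (prod_decode n))"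
  proof (rule UN_least)
    show "V p \<subseteq> (\<Union>n. V (prod_decode n))" for p
      using UN_upper[of "prod_encode p" UNIV "\<lambda>n. V (prod_decode n)"] by simp
  qed
  finally have "hausdorff_content \<delta> s A \<le> (\<Sum>n. ennreal (diameter (V (prod_decode n)) powr s))"
    unfolding hausdorff_content_def
    using V_small order_trans[OF conjunct2[OF V_small] r(2)] by (intro INF_lower) auto
  also have "\<dots> = (\<Sum>i. \<Sum>m. ennreal (diameter (V (i, m)) powr s))"
    by (rule suminf_ennreal_2dimen[where f = "\<lambda>p. ennreal (diameter (V p) powr s)"]) simp
  also have "\<dots> \<le> (\<Sum>i. ennreal (b i * r i powr s))"
  proof (intro suminf_le summableI)
    fix i
    have "(\<Sum>m. ennreal (diameter (V (i, m)) powr s))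
        = (\<Sum>m<card (\<U> i). ennreal (diameter (V (i, m)) powr s))"
      by (rule suminf_finite) (auto simp: V_def)
    also have "\<dots> \<le> (\<Sum>m<card (\<U> i). ennreal (r i powr s))"
      using V_small[of "(i, _)"] \<open>0 < s\<close>
      by (intro sum_mono ennreal_leI powr_mono2) (auto simp: diameter_ge_0)
    also have "\<dots> = ennreal (real (card (\<U> i)) * r i powr s)"
      by (simp add: ennreal_mult ennreal_of_nat_eq_real_of_nat)
    also have "\<dots> \<le> ennreal (b i * r i powr s)"
      using card by (intro ennreal_leI mult_right_mono) auto
    finally show "(\<Sum>m. ennreal (diameter (V (i, m)) powr s)) \<le> ennreal (b i * r i powr s)" .
  qed
  finally show ?thesis .
qed

text \<open>Hausdorff-Cantelli argument: every point of \<open>A\<close> lies in \<open>E i\<close>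
  for arbitrarily large \<open>i\<close>, so the covers of the \<open>E i\<close> with
  \<open>i \<ge> m\<close> together cover \<open>A\<close>, and their total cost is at most a tail
  of a convergent series.\<close>

lemma hausdorff_measure_eq_0I:
  assumes cover: "\<And>m. A \<subseteq> (\<Union>i\<in>{m..}. E i)"
    and small: "\<forall>\<^sub>F i in sequentially. \<exists>\<U>. finite \<U> \<and> real (card \<U>) \<le> b i \<and> E i \<subseteq> \<Union>\<U>
                  \<and> (\<forall>U\<in>\<U>. bounded U \<and> diameter U \<le> r i)"
    and r: "\<And>i. 0 \<le> r i" "r \<longlonglongrightarrow> 0" and "0 < s"
    and summ: "summable (\<lambda>i. b i * r i powr s)" and b: "\<And>i. 0 \<le> b i"
  shows "hausdorff_measure s A = 0"
proof -
  have "hausdorff_content \<delta> s A \<le> 0" if "0 < \<delta>" for \<delta>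
  proof (rule ennreal_le_epsilon)
    fix e :: real assume "0 < e"
    have nonneg: "0 \<le> b i * r i powr s" for i using b by simp
    have "\<forall>\<^sub>F i in sequentially. r i < \<delta>" using r(2) \<open>0 < \<delta>\<close> by (rule order_tendstoD)
    moreover have "\<forall>\<^sub>F m in sequentially. norm (\<Sum>i. b (i + m) * r (i + m) powr s) < e"
      using suminf_exist_split[OF \<open>0 < e\<close> summ] by (auto simp: eventually_sequentially)
    ultimately have ev: "\<forall>\<^sub>F m in sequentially. (\<forall>i\<ge>m. r i < \<delta> \<and> (\<exists>\<U>. finite \<U> \<and> real (card \<U>) \<le> b i \<and> E i \<subseteq> \<Union>\<U>
                  \<and> (\<forall>U\<in>\<U>. bounded U \<and> diameter U \<le> r i))) \<and> norm (\<Sum>i. b (i + m) * r (i + m) powr s) < e"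
      using small
      by (intro eventually_conj eventually_all_ge_at_top)
    \<comment> \<open>From \<open>m\<close> on the eventual covers exist and have diameters below
      \<open>\<delta>\<close>; together they cost less than \<open>e\<close>.\<close>
    obtain m where m\<^sub>0: "\<forall>i\<ge>m. r i < \<delta> \<and> (\<exists>\<U>. finite \<U> \<and> real (card \<U>) \<le> b i \<and> E i \<subseteq> \<Union>\<U>
                  \<and> (\<forall>U\<in>\<U>. bounded U \<and> diameter U \<le> r i))"
      and m: "norm (\<Sum>i. b (i + m) * r (i + m) powr s) < e"
      using eventually_happens'[OF sequentially_bot ev] by blast
    have "\<forall>i. r (i + m) < \<delta> \<and> (\<exists>\<U>. finite \<U> \<and> real (card \<U>) \<le> b (i + m) \<and> E (i + m) \<subseteq> \<Union>\<U>
                  \<and> (\<forall>U\<in>\<U>. bounded U \<and> diameter U \<le> r (i + m)))"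
      by (intro allI m\<^sub>0[rule_format] le_add2)
    then obtain \<U> where \<U>: "\<And>i. r (i + m) < \<delta> \<and> finite (\<U> i) \<and> real (card (\<U> i)) \<le> b (i + m) \<and> E (i + m) \<subseteq> \<Union>(\<U> i)
                  \<and> (\<forall>U\<in>\<U> i. bounded U \<and> diameter U \<le> r (i + m))"
      by metis
    have "A \<subseteq> (\<Union>i. \<Union>(\<U> i))"
    proof
      fix x assume "x \<in> A"
      then obtain i where "i \<ge> m" "x \<in> E i" using cover[of m] by blast
      then show "x \<in> (\<Union>i. \<Union>(\<U> i))" using \<U>[of "i - m"] by (intro UN_I[of "i - m"]) auto
    qed
    then have "hausdorff_content \<delta> s A \<le> (\<Sum>i. ennreal (b (i + m) * r (i + m) powr s))"
      using \<U> r(1) \<open>0 < s\<close>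
      by (intro hausdorff_content_le[where \<U> = \<U>]) (auto intro: less_imp_le)
    also have "\<dots> = ennreal (\<Sum>i. b (i + m) * r (i + m) powr s)"
      using nonneg summ by (intro suminf_ennreal2) (simp_all add: summable_iff_shift[of "\<lambda>i. b i * r i powr s"])
    also have "\<dots> \<le> ennreal e"
      using m by (intro ennreal_leI) auto
    finally show "hausdorff_content \<delta> s A \<le> 0 + ennreal e" by simp
  qed
  then show ?thesis
    unfolding hausdorff_measure_def by (auto simp: SUP_constant bot_ennreal intro!: antisym SUP_least)
qed

section \<open>Covering boxes by cubes and point sets by boxes\<close>

text \<open>The cubes are grid cells of mesh \<open>h\<close> with a vertex at \<open>x\<close>. In
  direction \<open>j\<close> at most \<open>4 * \<zeta> $ j / h + 2\<close> of them are taken; the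
  maximum with \<open>1\<close> provides for directions in which the box is thinner than
  \<open>h\<close>.\<close>

lemma box_cover_by_cubes:
  fixes x \<zeta> :: "real ^ 'd"
  assumes "0 < h" and \<zeta>: "\<And>j. 0 < \<zeta> $ j"
  obtains \<U> :: "(real ^ 'd) set set" where "finite \<U>"
    "{y. \<forall>j. \<bar>y $ j - x $ j\<bar> < 2 * \<zeta> $ j} \<subseteq> \<Union>\<U>"
    "real (card \<U>) \<le> 6 ^ CARD('d) * (\<Prod>j\<in>UNIV. max 1 (\<zeta> $ j / h))"
    "\<forall>U\<in>\<U>. bounded U \<and> diameter U \<le> real CARD('d) * h"
proof -
  define cube where "cube q = {y :: real ^ 'd. \<forall>j. \<lfloor>(y $ j - x $ j) / h\<rfloor> = q j}" for q
  \<comment> \<open>The lower end is one step further out because floors round downwards: a number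
    just above \<open>- (m + 1)\<close> has floor \<open>- (m + 1)\<close>.\<close>
  define Q where "Q j = {- (\<lfloor>2 * \<zeta> $ j / h\<rfloor> + 1) .. \<lfloor>2 * \<zeta> $ j / h\<rfloor>}" for j
  define \<U> where "\<U> = cube ` PiE UNIV Q"
  have fin: "finite (PiE UNIV Q)" by (intro finite_PiE) (auto simp: Q_def)
  have cardQ: "real (card (Q j)) \<le> 6 * max 1 (\<zeta> $ j / h)" for j
  proof -
    have "0 \<le> \<lfloor>2 * \<zeta> $ j / h\<rfloor>" using \<zeta>[of j] \<open>0 < h\<close> by simp
    then have "real (card (Q j)) = 2 * of_int \<lfloor>2 * \<zeta> $ j / h\<rfloor> + 2" by (simp add: Q_def)
    also have "\<dots> \<le> 2 * (2 * \<zeta> $ j / h) + 2"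
      by (intro add_right_mono mult_left_mono of_int_floor_le) auto
    also have "\<dots> \<le> 6 * max 1 (\<zeta> $ j / h)" by linarith
    finally show ?thesis .
  qed
  show ?thesis
  proof
    show "finite \<U>" using fin by (simp add: \<U>_def)
    show "{y. \<forall>j. \<bar>y $ j - x $ j\<bar> < 2 * \<zeta> $ j} \<subseteq> \<Union>\<U>"
    proof
      fix y assume "y \<in> {y. \<forall>j. \<bar>y $ j - x $ j\<bar> < 2 * \<zeta> $ j}"
      then have y: "\<bar>y $ j - x $ j\<bar> < 2 * \<zeta> $ j" for j by auto
      have "\<lfloor>(y $ j - x $ j) / h\<rfloor> \<in> Q j" for j
      proof -
        have "(y $ j - x $ j) / h \<le> 2 * \<zeta> $ j / h" "- (2 * \<zeta> $ j / h) \<le> (y $ j - x $ j) / h"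
          using y[of j] \<open>0 < h\<close> by (auto simp: divide_le_cancel field_simps)
        then have "\<lfloor>(y $ j - x $ j) / h\<rfloor> \<le> \<lfloor>2 * \<zeta> $ j / h\<rfloor>"
          "- (\<lfloor>2 * \<zeta> $ j / h\<rfloor> + 1) \<le> \<lfloor>(y $ j - x $ j) / h\<rfloor>" by linarith+
        then show ?thesis unfolding Q_def by auto
      qed
      then have "(\<lambda>j. \<lfloor>(y $ j - x $ j) / h\<rfloor>) \<in> PiE UNIV Q" by auto
      moreover have "y \<in> cube (\<lambda>j. \<lfloor>(y $ j - x $ j) / h\<rfloor>)" by (simp add: cube_def)
      ultimately show "y \<in> \<Union>\<U>" unfolding \<U>_def by blast
    qed
    have "real (card \<U>) \<le> real (card (PiE UNIV Q))"
      unfolding \<U>_def using card_image_le[OF fin] by simp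
    also have "\<dots> = (\<Prod>j\<in>UNIV. real (card (Q j)))" by (simp add: card_PiE)
    also have "\<dots> \<le> (\<Prod>j\<in>UNIV. 6 * max 1 (\<zeta> $ j / h))"
      using cardQ by (intro prod_mono) auto
    also have "\<dots> = 6 ^ CARD('d) * (\<Prod>j\<in>UNIV. max 1 (\<zeta> $ j / h))"
      by (simp add: prod.distrib)
    finally show "real (card \<U>) \<le> 6 ^ CARD('d) * (\<Prod>j\<in>UNIV. max 1 (\<zeta> $ j / h))" .
    show "\<forall>U\<in>\<U>. bounded U \<and> diameter U \<le> real CARD('d) * h"
    proof
      fix U assume "U \<in> \<U>"
      then obtain q where U: "U = cube q" unfolding \<U>_def by blast
      have D: "norm (y - z) \<le> real CARD('d) * h" if "y \<in> U" "z \<in> U" for y z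
      proof -
        have "\<bar>(y - z) $ j\<bar> \<le> h" for j
        proof -
          have "\<lfloor>(y $ j - x $ j) / h\<rfloor> = \<lfloor>(z $ j - x $ j) / h\<rfloor>"
            using that by (simp add: U cube_def)
          then have "\<bar>(y $ j - x $ j) / h - (z $ j - x $ j) / h\<bar> \<le> 1" by linarith
          then show ?thesis using \<open>0 < h\<close> by (simp add: field_simps abs_le_iff)
        qed
        \<comment> \<open>The norm is bounded by the sum of the moduli of the coordinates, hence the
          factor \<open>CARD('d)\<close>.\<close>
        then have "(\<Sum>j\<in>UNIV. \<bar>(y - z) $ j\<bar>) \<le> (\<Sum>j\<in>(UNIV::'d set). h)" by (intro sum_mono)
        then show ?thesis using norm_le_l1_cart[of "y - z"] by simp
      qed
      have "bounded U"
      proof (cases "U = {}")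
        case False
        then obtain z where "z \<in> U" by blast
        then have "U \<subseteq> cball z (real CARD('d) * h)"
          using D by (auto simp: dist_norm)
        then show ?thesis using bounded_cball bounded_subset by blast
      qed simp
      moreover have "diameter U \<le> real CARD('d) * h"
        using D \<open>0 < h\<close> by (intro diameter_le) auto
      ultimately show "bounded U \<and> diameter U \<le> real CARD('d) * h" ..
    qed
  qed
qed

lemma rect_borel [measurable]: "rect (x :: real ^ 'd) \<zeta> \<in> sets borel"
proof -
  have "rect x \<zeta> = (\<Inter>j. {y. x $ j - \<zeta> $ j \<le> y $ j} \<inter> {y. y $ j < x $ j + \<zeta> $ j})"
    by (auto simp: rect_def)
  moreover have "{y :: real ^ 'd. x $ j - \<zeta> $ j \<le> y $ j} \<in> sets borel"
    "{y :: real ^ 'd. y $ j < x $ j + \<zeta> $ j} \<in> sets borel" for j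
    by (auto intro!: borel_closed borel_open closed_Collect_le open_Collect_less continuous_intros)
  ultimately show ?thesis by auto
qed

text \<open>Vitali's argument for translates of one rectangle. Disjoint rectangles centred in
  \<open>S\<close> lie in \<open>G\<close> and have mass at least \<open>c\<close> each, which
  bounds their number and so provides a largest disjoint family. Any further rectangle meets one of
  this family, so its centre lies in the doubled one.\<close>

lemma finite_cover_by_doubled_rects:
  fixes \<mu> :: "(real ^ 'd) measure"
  assumes "finite_measure \<mu>" "sets \<mu> = sets borel" "G \<in> sets borel"
    and sub: "\<And>x. x \<in> S \<Longrightarrow> rect x \<zeta> \<subseteq> G"
    and lower: "\<And>x. x \<in> S \<Longrightarrow> c \<le> measure \<mu> (rect x \<zeta>)" and "0 < c"
    and \<zeta>: "\<And>j. 0 < \<zeta> $ j"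
  obtains F where "finite F" "real (card F) \<le> measure \<mu> G / c"
    "S \<subseteq> (\<Union>x\<in>F. {y. \<forall>j. \<bar>y $ j - x $ j\<bar> < 2 * \<zeta> $ j})"
proof -
  interpret finite_measure \<mu> by fact
  define P where "P F \<longleftrightarrow> finite F \<and> F \<subseteq> S \<and> disjoint_family_on (\<lambda>x. rect x \<zeta>) F" for F
  have bound: "real (card F) \<le> measure \<mu> G / c" if "P F" for F
  proof -
    have "real (card F) * c = (\<Sum>x\<in>F. c)" by simp
    also have "\<dots> \<le> (\<Sum>x\<in>F. measure \<mu> (rect x \<zeta>))"
      using that lower by (intro sum_mono) (auto simp: P_def)
    also have "\<dots> = measure \<mu> (\<Union>x\<in>F. rect x \<zeta>)"
      using that assms(2) by (intro finite_measure_finite_Union[symmetric]) (auto simp: P_def)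
    also have "\<dots> \<le> measure \<mu> G"
      using that sub assms(2,3) by (intro finite_measure_mono) (auto simp: P_def)
    finally show ?thesis using \<open>0 < c\<close> by (simp add: field_simps)
  qed
  have "P {}" by (simp add: P_def disjoint_family_on_def)
  moreover have "\<forall>F. P F \<longrightarrow> card F < Suc (nat \<lfloor>measure \<mu> G / c\<rfloor>)"
    using bound by (auto simp: less_Suc_eq_le le_nat_floor)
  ultimately obtain F where F: "P F" "\<And>F'. P F' \<Longrightarrow> card F' \<le> card F"
    using Lattices_Big.ex_has_greatest_nat[of P "{}" card] by blast
  show ?thesis
  proof
    show "finite F" using F(1) by (simp add: P_def)
    show "real (card F) \<le> measure \<mu> G / c" using bound F(1) by simp
    show "S \<subseteq> (\<Union>x\<in>F. {y. \<forall>j. \<bar>y $ j - x $ j\<bar> < 2 * \<zeta> $ j})"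
    proof
      fix y assume "y \<in> S"
      show "y \<in> (\<Union>x\<in>F. {y. \<forall>j. \<bar>y $ j - x $ j\<bar> < 2 * \<zeta> $ j})"
      proof (cases "y \<in> F")
        case True
        then show ?thesis using \<zeta> by (intro UN_I[of y]) auto
      next
        case False
        have "\<not> P (insert y F)"
          using F(2)[of "insert y F"] False F(1) by (auto simp: P_def)
        then have "(\<Union>x\<in>F. rect x \<zeta>) \<inter> rect y \<zeta> \<noteq> {}"
          using F(1) False \<open>y \<in> S\<close> by (auto simp: P_def disjoint_family_on_insert)
        then obtain x z where "x \<in> F" "z \<in> rect x \<zeta>" "z \<in> rect y \<zeta>" by blast
        then have "x $ j - \<zeta> $ j \<le> z $ j \<and> z $ j < x $ j + \<zeta> $ j"
          "y $ j - \<zeta> $ j \<le> z $ j \<and> z $ j < y $ j + \<zeta> $ j" for j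
          by (auto simp: rect_def)
        \<comment> \<open>Half-open intervals of equal length that share a point have centres
          strictly closer than that length.\<close>
        then have "\<bar>y $ j - x $ j\<bar> < 2 * \<zeta> $ j" for j
          by (smt (verit, best))
        then show ?thesis using \<open>x \<in> F\<close> by blast
      qed
    qed
  qed
qed

section \<open>Dyadic blocks and random signs\<close>

text \<open>The binary digits of \<open>M\<close> cut \<open>{1..M}\<close> into at most
  \<open>i + 1\<close> dyadic blocks, at most one of each length \<open>2 ^ l\<close>, and some
  block sum has at least the fraction \<open>1 / (i + 1)\<close> of the norm of the whole. The shift
  in \<open>(n - 1) div 2 ^ l\<close> turns block \<open>j\<close> into
  \<open>{j * 2 ^ l + 1..(j + 1) * 2 ^ l}\<close>.\<close>

lemma prefix_le_dyadic_block:
  fixes f :: "nat \<Rightarrow> 'a::real_normed_vector"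
  assumes "M \<le> 2 ^ i"
  shows "\<exists>l\<le>i. \<exists>j<2 ^ i. norm (\<Sum>n=1..M. f n)
           \<le> (real i + 1) * norm (\<Sum>n | n \<in> {1..2 ^ i} \<and> (n - 1) div 2 ^ l = j. f n)"
proof -
  define P where "P m = (\<Sum>n=1..m. f n)" for m
  \<comment> \<open>\<open>M' l\<close> is \<open>M\<close> with its lowest \<open>l\<close> binary
    digits cleared; it falls from \<open>M\<close> at \<open>l = 0\<close> to \<open>0\<close> at
    \<open>l = i + 1\<close>.\<close>
  define M' where "M' l = 2 ^ l * (M div 2 ^ l)" for l
  have "M < 2 ^ Suc i" using assms by (simp add: le_less_trans)
  then have M': "M' 0 = M" "M' (Suc i) = 0" by (simp_all add: M'_def)
  have tele: "P M = (\<Sum>l\<le>i. P (M' l) - P (M' (Suc l)))"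
    using sum_telescope[of "\<lambda>l. P (M' l)" i] M' by (simp add: P_def)
  have ex: "\<exists>l\<le>i. norm (P M) \<le> (real i + 1) * norm (P (M' l) - P (M' (Suc l)))"
  proof (rule ccontr)
    assume neg: "\<not> ?thesis"
    then have *: "norm (P (M' l) - P (M' (Suc l))) < norm (P M) / (real i + 1)" if "l \<le> i" for l
    proof -
      have "(real i + 1) * norm (P (M' l) - P (M' (Suc l))) < norm (P M)"
        using neg that by (meson not_le)
      then show ?thesis by (simp add: pos_less_divide_eq mult.commute)
    qed
    have "norm (P M) \<le> (\<Sum>l\<le>i. norm (P (M' l) - P (M' (Suc l))))"
      by (subst tele) (rule norm_sum)
    also have "\<dots> < (\<Sum>l\<le>i. norm (P M) / (real i + 1))"
      using * by (intro sum_strict_mono) auto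
    also have "\<dots> = norm (P M)" by (simp add: field_simps)
    finally show False by simp
  qed
  then obtain l where l: "l \<le> i" "norm (P M) \<le> (real i + 1) * norm (P (M' l) - P (M' (Suc l)))"
    by blast
  define q where "q = M div 2 ^ l"
  have M'l: "M' l = 2 ^ l * q" "M' (Suc l) = 2 ^ l * (2 * (q div 2))"
    by (simp_all add: M'_def q_def div_mult2_eq[symmetric] mult.commute)
  show ?thesis
  proof (cases "even q")
    \<comment> \<open>Digit \<open>l\<close> of \<open>M\<close> is \<open>0\<close>: the two
      truncations agree, so the whole prefix sum vanishes and any block will do.\<close>
    case True
    then have "norm (P M) \<le> 0" using l(2) M'l by simp
    then show ?thesis by (intro exI[of _ l] conjI exI[of _ 0]) (auto simp: P_def l(1))
  next
    case False
    \<comment> \<open>Digit \<open>l\<close> is \<open>1\<close>: the truncations differ by one full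
      block of length \<open>2 ^ l\<close>, the one with index \<open>q - 1\<close>.\<close>
    then have q: "2 * (q div 2) = q - 1" "q \<ge> 1" by (auto elim: oddE)
    have qM: "2 ^ l * q \<le> 2 ^ i" using assms by (metis q_def div_times_less_eq_dividend mult.commute order_trans)
    have "(n - 1) div 2 ^ l = q - 1 \<longleftrightarrow> 2 ^ l * (q - 1) < n \<and> n \<le> 2 ^ l * q" if "1 \<le> n" for n :: nat
    proof -
      have "(n - 1) div 2 ^ l = q - 1 \<longleftrightarrow> (q - 1) * 2 ^ l \<le> n - 1 \<and> n - 1 < Suc (q - 1) * 2 ^ l"
        by (metis div_nat_eqI dividend_less_times_div div_times_less_eq_dividend mult.commute
            mult_Suc zero_less_numeral zero_less_power)
      also have "Suc (q - 1) = q" using q by simp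
      finally show ?thesis using that by (auto simp: mult.commute)
    qed
    then have set_eq: "{n. n \<in> {1..2 ^ i} \<and> (n - 1) div 2 ^ l = q - 1} = {1..2 ^ l * q} - {1..2 ^ l * (q - 1)}"
      using qM by auto
    have "P (M' l) - P (M' (Suc l)) = (\<Sum>n\<in>{1..2 ^ l * q} - {1..2 ^ l * (q - 1)}. f n)"
      unfolding P_def M'l q(1) by (subst sum_diff) (auto intro: order_trans)
    moreover have "q - 1 < 2 ^ i"
    proof -
      have "q \<le> 2 ^ l * q" by simp
      then show ?thesis using qM q(2) by linarith
    qed
    ultimately show ?thesis
      using l set_eq unfolding P_def by (intro exI[of _ l] conjI exI[of _ "q - 1"]) auto
  qed
qed

text \<open>For each choice of signs off the block \<open>j\<close>, the two choices of sign on the block give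
  signed sums that differ by twice the sum over the block, so one of them is at least as large
  as that sum. The argument needs no convexity and hence covers \<open>\<rho> < 1\<close>.\<close>

lemma block_sum_le_sign_average:
  fixes f :: "nat \<Rightarrow> 'a::real_normed_vector"
  assumes "finite X" "finite Y" "j \<in> Y" "0 < \<rho>"
  shows "2 ^ (card Y - 1) * norm (\<Sum>n | n \<in> X \<and> p n = j. f n) powr \<rho>
       \<le> (\<Sum>J\<in>Pow Y. norm (\<Sum>n\<in>X. if p n \<in> J then f n else - f n) powr \<rho>)"
proof -
  define B where "B = (\<Sum>n | n \<in> X \<and> p n = j. f n)"
  define W where "W J = (\<Sum>n\<in>X. if p n \<in> J then f n else - f n)" for J
  define Y' where "Y' = Y - {j}"
  have Y: "Y = insert j Y'" "j \<notin> Y'" "finite Y'" "card Y - 1 = card Y'"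
    using assms by (auto simp: Y'_def)
  have pair: "norm B powr \<rho> \<le> norm (W J) powr \<rho> + norm (W (insert j J)) powr \<rho>" if "J \<subseteq> Y'" for J
  proof -
    have "W (insert j J) - W J = (\<Sum>n\<in>X. if p n = j then 2 *\<^sub>R f n else 0)"
      unfolding W_def sum_subtractf[symmetric]
      using that Y by (intro sum.cong) (auto simp: scaleR_2)
    also have "\<dots> = 2 *\<^sub>R B"
      unfolding B_def scaleR_sum_right using assms(1) by (subst sum.inter_filter[symmetric]) auto
    finally have "2 * norm B = norm (W (insert j J) - W J)" by simp
    also have "\<dots> \<le> norm (W (insert j J)) + norm (W J)" by (rule norm_triangle_ineq4)
    finally have "norm B \<le> norm (W J) \<or> norm B \<le> norm (W (insert j J))" by linarith
    then show ?thesis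
      using \<open>0 < \<rho>\<close>
      by (smt (verit) norm_ge_zero powr_ge_zero powr_mono2)
  qed
  \<comment> \<open>The subsets of \<open>Y\<close> fall into pairs \<open>J\<close>,
    \<open>insert j J\<close> with \<open>J \<subseteq> Y'\<close>, which accounts for the factor
    \<open>2 ^ card Y'\<close>.\<close>
  have "2 ^ card Y' * norm B powr \<rho> = (\<Sum>J\<in>Pow Y'. norm B powr \<rho>)"
    using Y by (simp add: card_Pow)
  also have "\<dots> \<le> (\<Sum>J\<in>Pow Y'. norm (W J) powr \<rho> + norm (W (insert j J)) powr \<rho>)"
    using pair by (intro sum_mono) auto
  also have "\<dots> = (\<Sum>J\<in>Pow Y'. norm (W J) powr \<rho>) + (\<Sum>J\<in>insert j ` Pow Y'. norm (W J) powr \<rho>)"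
    using Y by (subst sum.reindex) (auto simp: sum.distrib inj_on_def)
  also have "\<dots> = (\<Sum>J\<in>Pow Y' \<union> insert j ` Pow Y'. norm (W J) powr \<rho>)"
    using Y by (intro sum.union_disjoint[symmetric]) auto
  also have "Pow Y' \<union> insert j ` Pow Y' = Pow Y" unfolding Y(1) by (rule Pow_insert[symmetric])
  finally show ?thesis unfolding Y(4) B_def W_def .
qed

section \<open>Large block sums of Weyl sums\<close>

lemma norm_expi [simp]: "norm (expi x) = 1"
  by (simp add: expi_def norm_exp_eq_Re)

text \<open>A chord of the unit circle is no longer than its arc.\<close>

lemma norm_expi_diff_le: "norm (expi x - expi y) \<le> 2 * pi * \<bar>x - y\<bar>"
proof -
  define t where "t = 2 * pi * (x - y)"
  have "expi x - expi y = expi y * (exp (\<i> * of_real t) - 1)"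
    by (simp add: expi_def t_def algebra_simps flip: exp_add)
  then have "norm (expi x - expi y) = 2 * \<bar>sin (t / 2)\<bar>"
    by (simp add: norm_mult dist_exp_i_1)
  also have "\<dots> \<le> \<bar>t\<bar>" using abs_sin_x_le_abs_x[of "t / 2"] by simp
  also have "\<dots> = 2 * pi * \<bar>x - y\<bar>" by (simp add: t_def abs_mult)
  finally show ?thesis .
qed

text \<open>The summand gets its own name so that it can be summed over dyadic blocks as well as
  over prefixes.\<close>

definition weyl_term :: "(nat \<Rightarrow> complex) \<Rightarrow> real ^ 'd::{finite,linorder} \<Rightarrow> nat \<Rightarrow> complex" where
  "weyl_term a x n = a n * expi (\<Sum>j\<in>UNIV. x $ j * real n ^ coord_no j)"

lemma weyl_sum_eq_sum_weyl_term: "weyl_sum a x N = (\<Sum>n=1..N. weyl_term a x n)"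
  by (simp add: weyl_sum_def weyl_term_def)

lemma continuous_on_weyl_term [continuous_intros]: "continuous_on S (\<lambda>x. weyl_term a x n)"
  unfolding weyl_term_def expi_def by (intro continuous_intros)

lemma norm_weyl_sum_le: "norm (weyl_sum a x N) \<le> (\<Sum>n=1..N. norm (a n))"
  unfolding weyl_sum_def by (intro order_trans[OF norm_sum] sum_mono) (simp add: norm_mult)

text \<open>The phase is linear in the point, with coefficients
  \<open>n ^ coord_no j \<le> N ^ coord_no j\<close>, so it moves by at most
  \<open>CARD('d) * D\<close>. The at most \<open>N\<close> terms are compared one by one.\<close>

lemma weyl_term_sum_perturbation:
  fixes x y :: "real ^ 'd::{finite,linorder}"
  assumes a: "\<And>n. n \<in> {1..N} \<Longrightarrow> norm (a n) \<le> A" and "0 \<le> A" and X: "X \<subseteq> {1..N}"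
    and D: "\<And>j. \<bar>y $ j - x $ j\<bar> * real N ^ coord_no j \<le> D" and "0 \<le> D"
  shows "norm ((\<Sum>n\<in>X. weyl_term a y n) - (\<Sum>n\<in>X. weyl_term a x n))
       \<le> real N * A * (2 * pi * (real CARD('d) * D))"
proof -
  have "norm (weyl_term a y n - weyl_term a x n) \<le> A * (2 * pi * (real CARD('d) * D))" if "n \<in> X" for n
  proof -
    have n: "n \<in> {1..N}" using X that by blast
    have "\<bar>(\<Sum>j\<in>UNIV. y $ j * real n ^ coord_no j) - (\<Sum>j\<in>UNIV. x $ j * real n ^ coord_no j)\<bar>
        \<le> (\<Sum>j\<in>UNIV. \<bar>(y $ j - x $ j) * real n ^ coord_no j\<bar>)"
      unfolding sum_subtractf[symmetric] left_diff_distrib[symmetric] by (rule sum_abs)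
    also have "\<dots> \<le> (\<Sum>j\<in>(UNIV :: 'd set). D)"
    proof (rule sum_mono)
      fix j :: 'd
      have "\<bar>(y $ j - x $ j) * real n ^ coord_no j\<bar> \<le> \<bar>y $ j - x $ j\<bar> * real N ^ coord_no j"
        using n by (auto simp: abs_mult intro!: mult_left_mono power_mono)
      then show "\<bar>(y $ j - x $ j) * real n ^ coord_no j\<bar> \<le> D" using D[of j] by linarith
    qed
    finally have phase: "\<bar>(\<Sum>j\<in>UNIV. y $ j * real n ^ coord_no j) - (\<Sum>j\<in>UNIV. x $ j * real n ^ coord_no j)\<bar>
        \<le> real CARD('d) * D" by simp
    have "norm (weyl_term a y n - weyl_term a x n) = norm (a n) *
        norm (expi (\<Sum>j\<in>UNIV. y $ j * real n ^ coord_no j) - expi (\<Sum>j\<in>UNIV. x $ j * real n ^ coord_no j))"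
      by (simp add: weyl_term_def norm_mult flip: right_diff_distrib)
    also have "\<dots> \<le> A * (2 * pi * (real CARD('d) * D))"
    proof (rule mult_mono)
      show "norm (a n) \<le> A" by (rule a[OF n])
      show "norm (expi (\<Sum>j\<in>UNIV. y $ j * real n ^ coord_no j) - expi (\<Sum>j\<in>UNIV. x $ j * real n ^ coord_no j))
          \<le> 2 * pi * (real CARD('d) * D)"
        by (rule order_trans[OF norm_expi_diff_le]) (intro mult_left_mono phase, simp)
    qed (use \<open>0 \<le> A\<close> in auto)
    finally show ?thesis .
  qed
  then have "norm (\<Sum>n\<in>X. weyl_term a y n - weyl_term a x n)
      \<le> real (card X) * (A * (2 * pi * (real CARD('d) * D)))"
    by (intro order_trans[OF norm_sum] sum_bounded_above) auto
  also have "\<dots> \<le> real N * (A * (2 * pi * (real CARD('d) * D)))"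
    using card_mono[OF _ X] \<open>0 \<le> A\<close> \<open>0 \<le> D\<close> by (intro mult_right_mono) auto
  finally show ?thesis by (simp add: sum_subtractf mult.assoc)
qed

section \<open>Growth rates and uniformity in the coefficients\<close>

lemma eventually_const_le_powr:
  assumes "0 < \<epsilon>"
  shows "\<forall>\<^sub>F N in sequentially. B \<le> real N powr \<epsilon>"
proof -
  have "(\<lambda>N. real N powr (- \<epsilon>)) \<longlonglongrightarrow> 0"
    using assms by (intro tendsto_neg_powr filterlim_real_sequentially) auto
  then have "\<forall>\<^sub>F N in sequentially. real N powr (- \<epsilon>) < 1 / (\<bar>B\<bar> + 1)"
    by (rule order_tendstoD) simp
  moreover have "\<forall>\<^sub>F N :: nat in sequentially. 0 < N" by (rule eventually_gt_at_top)
  ultimately show ?thesis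
  proof eventually_elim
    case (elim N)
    then have "\<bar>B\<bar> + 1 < real N powr \<epsilon>"
      by (simp add: powr_minus field_simps)
    then show ?case by simp
  qed
qed

text \<open>\<open>i + 1\<close> is logarithmic in \<open>2 ^ i\<close>, so every positive power
  wins. This absorbs the loss from the number of block lengths.\<close>

lemma eventually_linear_le_powr:
  assumes "0 < \<epsilon>"
  shows "\<forall>\<^sub>F i in sequentially. K * (real i + 1) \<le> (2 ^ i) powr \<epsilon>"
proof -
  define q where "q = 2 powr (- \<epsilon>)"
  have q: "0 < q" "q < 1" using assms powr_less_mono[of "- \<epsilon>" 0 2] by (auto simp: q_def)
  have "(\<lambda>i. K * (real i * q ^ i + q ^ i)) \<longlonglongrightarrow> K * (0 + 0)"
    using q by (intro tendsto_intros powser_times_n_limit_0 LIMSEQ_power_zero) auto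
  then have "\<forall>\<^sub>F i in sequentially. K * (real i * q ^ i + q ^ i) < 1"
    by (intro order_tendstoD) auto
  then show ?thesis
  proof eventually_elim
    case (elim i)
    have "(2 ^ i) powr \<epsilon> = 2 powr (real i * \<epsilon>)" "q ^ i = 2 powr (- (real i * \<epsilon>))"
      using q(1) by (simp_all add: powr_realpow[symmetric] powr_powr, simp_all add: q_def powr_powr mult.commute)
    then have "(2 ^ i) powr \<epsilon> * q ^ i = 1" by (simp flip: powr_add)
    then have "K * (real i + 1) * q ^ i < (2 ^ i) powr \<epsilon> * q ^ i"
      using elim by (simp add: algebra_simps)
    then show ?case using q by simp
  qed
qed

text \<open>The finitely many early terms, each bounded in terms of its own size only, are overtaken
  by a power of \<open>N\<close>.\<close>

lemma subpolynomial_imp_max_le: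
  assumes "subpolynomial a" "0 < \<epsilon>"
  shows "\<forall>\<^sub>F N in sequentially. \<forall>n\<in>{1..N}. norm (a n) \<le> real N powr \<epsilon>"
proof -
  obtain n\<^sub>0 where n\<^sub>0: "\<And>n. n \<ge> n\<^sub>0 \<Longrightarrow> norm (a n) \<le> real n powr \<epsilon>"
    using assms by (auto simp: subpolynomial_def eventually_sequentially)
  define B where "B = (\<Sum>n<n\<^sub>0. norm (a n))"
  have B: "norm (a n) \<le> B" if "n < n\<^sub>0" for n
    unfolding B_def using that by (intro member_le_sum) auto
  from eventually_const_le_powr[OF \<open>0 < \<epsilon>\<close>, of B] show ?thesis
  proof eventually_elim
    case (elim N)
    show ?case
    proof
      fix n assume n: "n \<in> {1..N}"
      show "norm (a n) \<le> real N powr \<epsilon>"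
      proof (cases "n < n\<^sub>0")
        case True
        then show ?thesis using B elim by force
      next
        case False
        then have "norm (a n) \<le> real n powr \<epsilon>" by (intro n\<^sub>0) simp
        also have "\<dots> \<le> real N powr \<epsilon>" using n \<open>0 < \<epsilon>\<close> by (intro powr_mono2) auto
        finally show ?thesis .
      qed
    qed
  qed
qed

text \<open>The mean value hypothesis allows the coefficients to vary with \<open>N\<close>, so it may be applied
  to a worst choice of coefficients for every \<open>N\<close>.\<close>

lemma mean_value_bound_uniform:
  fixes \<mu> :: "(real ^ 'd::{finite,linorder}) measure"
  assumes "mean_value_bound \<mu> \<rho> \<theta>" "subpolynomial a" "0 < \<epsilon>"
  shows "\<forall>\<^sub>F N in sequentially. \<forall>b. (\<forall>n\<in>{1..N}. norm (b n) \<le> norm (a n)) \<longrightarrow>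
           (LINT x:torus|\<mu>. norm (weyl_sum b x N) powr \<rho>) \<le> real N powr (\<theta> * \<rho> + \<epsilon>)"
proof -
  define bad where "bad N b \<longleftrightarrow> (\<forall>n\<in>{1..N}. norm (b n) \<le> norm (a n)) \<and>
    \<not> (LINT x:torus|\<mu>. norm (weyl_sum b x N) powr \<rho>) \<le> real N powr (\<theta> * \<rho> + \<epsilon>)" for N b
  \<comment> \<open>A counterexample is chosen wherever there is one; the default \<open>a\<close>
    keeps \<open>A N\<close> dominated by \<open>a\<close> for the other \<open>N\<close>.\<close>
  define A where "A N = (if \<exists>b. bad N b then SOME b. bad N b else a)" for N
  have A_bad: "bad N (A N)" if "bad N b" for N b
    unfolding A_def using someI[of "bad N", OF that] that by auto
  have A_le: "norm (A N n) \<le> norm (a n)" if "n \<in> {1..N}" for N n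
    using that A_bad[of N] by (cases "\<exists>b. bad N b") (auto simp: bad_def A_def)
  have "subpolynomial2 A"
    unfolding subpolynomial2_def
  proof (intro allI impI)
    fix \<epsilon>' :: real assume "0 < \<epsilon>'"
    from subpolynomial_imp_max_le[OF assms(2) this]
    show "\<forall>\<^sub>F N in sequentially. \<forall>n\<in>{1..N}. norm (A N n) \<le> real N powr \<epsilon>'"
      by eventually_elim (meson A_le order_trans)
  qed
  then have "\<forall>\<^sub>F N in sequentially.
      (LINT x:torus|\<mu>. norm (weyl_sum (A N) x N) powr \<rho>) \<le> real N powr (\<theta> * \<rho> + \<epsilon>)"
    using assms(1,3) by (simp add: mean_value_bound_def)
  then show ?thesis
  proof eventually_elim
    case (elim N)
    then have "\<not> bad N b" for b using A_bad[of N b] by (auto simp: bad_def)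
    then show ?case by (auto simp: bad_def)
  qed
qed

section \<open>Measure of the set of large block sums\<close>

lemma torus_borel: "(torus :: (real ^ 'd) set) \<in> sets borel"
proof -
  have "(torus :: (real ^ 'd) set) = (\<Inter>j. {y. 0 \<le> y $ j} \<inter> {y. y $ j < 1})"
    by (auto simp: torus_def)
  moreover have "{y :: real ^ 'd. 0 \<le> y $ j} \<in> sets borel" "{y :: real ^ 'd. y $ j < 1} \<in> sets borel" for j
    by (auto intro!: borel_closed borel_open closed_Collect_le open_Collect_less continuous_intros)
  then have "(\<Inter>j. {y :: real ^ 'd. 0 \<le> y $ j} \<inter> {y. y $ j < 1}) \<in> sets borel" by auto
  ultimately show ?thesis by simp
qed

lemma torus_radon_measure_integral:
  assumes "torus_radon_measure \<mu>" "f \<in> borel_measurable borel"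
  shows "(LINT x:torus|\<mu>. f x) = (LINT x|\<mu>. (f x :: real))"
  unfolding set_lebesgue_integral_def
proof (rule integral_cong_AE)
  have s: "sets \<mu> = sets borel" using assms(1) by (simp add: torus_radon_measure_def)
  then show "f \<in> borel_measurable \<mu>"
    using assms(2) by (subst measurable_cong_sets[OF s refl])
  then show "(\<lambda>x. indicat_real torus x *\<^sub>R f x) \<in> borel_measurable \<mu>"
    by (intro borel_measurable_scaleR borel_measurable_indicator) (simp_all add: torus_borel s)
  have "- torus \<in> null_sets \<mu>"
    using assms(1) by (intro null_setsI) (simp_all add: torus_radon_measure_def borel_comp[OF torus_borel] s)
  then have "AE x in \<mu>. x \<notin> - torus" by (rule AE_not_in)
  then show "AE x in \<mu>. indicat_real torus x *\<^sub>R f x = f x" by eventually_elim simp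
qed

text \<open>The range \<open>j < 2 ^ i\<close> is the same for every block length, so that one set
  of sign patterns serves all \<open>l\<close>.\<close>

definition large_blocks ::
  "(nat \<Rightarrow> complex) \<Rightarrow> nat \<Rightarrow> real \<Rightarrow> (real ^ 'd::{finite,linorder}) set" where
  "large_blocks a i \<tau> = {y. \<exists>l\<le>i. \<exists>j<2 ^ i.
     \<tau> \<le> norm (\<Sum>n | n \<in> {1..2 ^ i} \<and> (n - 1) div 2 ^ l = j. weyl_term a y n)}"

lemma large_blocks_borel: "(large_blocks a i \<tau> :: (real ^ 'd::{finite,linorder}) set) \<in> sets borel"
proof -
  have "large_blocks a i \<tau> = (\<Union>l\<in>{..i}. \<Union>j\<in>{..<2 ^ i}.
      {y :: real ^ 'd::{finite,linorder}. \<tau> \<le> norm (\<Sum>n | n \<in> {1..2 ^ i} \<and> (n - 1) div 2 ^ l = j. weyl_term a y n)})"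
    by (auto simp: large_blocks_def)
  moreover have "closed {y :: real ^ 'd::{finite,linorder}. \<tau> \<le> norm (\<Sum>n | n \<in> {1..2 ^ i} \<and> (n - 1) div 2 ^ l = j. weyl_term a y n)}"
    for l j :: nat
    by (intro closed_Collect_le continuous_intros)
  ultimately show ?thesis by (auto intro!: borel_closed)
qed

text \<open>Markov's inequality for the sum \<open>g\<close> over all block lengths and sign
  patterns. For a fixed length the sign average dominates every block at once, so the loss is the
  number \<open>i + 1\<close> of lengths and not the number of blocks.\<close>

lemma measure_large_blocks_le:
  fixes \<mu> :: "(real ^ 'd::{finite,linorder}) measure"
  assumes \<mu>: "torus_radon_measure \<mu>" and "0 < \<rho>" "0 < \<tau>"
    and B: "\<And>b. (\<And>n. norm (b n) = norm (a n)) \<Longrightarrow>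
           (LINT x:torus|\<mu>. norm (weyl_sum b x (2 ^ i)) powr \<rho>) \<le> B"
  shows "measure \<mu> (large_blocks a i \<tau>) \<le> 2 * (real i + 1) * B / \<tau> powr \<rho>"
proof -
  interpret finite_measure \<mu> using \<mu> by (simp add: torus_radon_measure_def)
  have s [measurable_cong]: "sets \<mu> = sets borel" using \<mu> by (simp add: torus_radon_measure_def)
  have sp: "space \<mu> = UNIV" using sets_eq_imp_space_eq[OF s] by simp
  \<comment> \<open>Changing signs keeps the moduli of the coefficients, so the bound
    \<open>B\<close> holds for each of these sums.\<close>
  define c where "c l J n = (if (n - 1) div 2 ^ l \<in> J then a n else - a n)" for l J n
  define w where "w l J y = norm (weyl_sum (c l J) y (2 ^ i)) powr \<rho>" for l J and y :: "real ^ 'd::{finite,linorder}"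
  define P where "P = Pow {..<2 ^ i :: nat}"
  define g where "g y = (\<Sum>l\<le>i. \<Sum>J\<in>P. w l J y)" for y
  \<comment> \<open>Half the number of sign patterns: the factor gained from
    \<open>block_sum_le_sign_average\<close>. The quotient of the two counts is the \<open>2\<close>
    in the conclusion.\<close>
  define K where "K = (2 :: real) ^ (2 ^ i - 1)"
  have K: "0 < K" "real (card P) = 2 * K"
    using power_Suc[of "2 :: real" "2 ^ i - 1"] by (simp_all add: K_def P_def card_Pow)
  have w_meas: "w l J \<in> borel_measurable borel" for l J
    unfolding w_def weyl_sum_eq_sum_weyl_term
    by (intro powr_real_measurable borel_measurable_const borel_measurable_continuous_onI
        continuous_intros)
  have w_int: "integrable \<mu> (w l J)" for l J
  proof (rule integrable_const_bound)
    show "AE y in \<mu>. norm (w l J y) \<le> (\<Sum>n=1..2 ^ i. norm (c l J n)) powr \<rho>"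
      unfolding w_def using norm_weyl_sum_le \<open>0 < \<rho>\<close> by (auto intro!: AE_I2 powr_mono2)
    show "w l J \<in> borel_measurable \<mu>" using w_meas by (simp add: measurable_cong_sets[OF s refl])
  qed
  have w_le: "(LINT y|\<mu>. w l J y) \<le> B" for l J
    using B[of "c l J"] torus_radon_measure_integral[OF \<mu> w_meas[of l J]]
    by (simp add: w_def c_def)
  have g_int: "integrable \<mu> g" unfolding g_def using w_int by (intro Bochner_Integration.integrable_sum)
  have "(LINT y|\<mu>. g y) = (\<Sum>l\<le>i. \<Sum>J\<in>P. LINT y|\<mu>. w l J y)"
    unfolding g_def using w_int by (simp add: Bochner_Integration.integral_sum)
  also have "\<dots> \<le> (\<Sum>l\<le>i. \<Sum>J\<in>P. B)" using w_le by (intro sum_mono)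
  also have "\<dots> = (real i + 1) * (2 * K) * B" by (simp add: K)
  finally have g_le: "(LINT y|\<mu>. g y) \<le> (real i + 1) * (2 * K) * B" .
  have g_nonneg: "0 \<le> g y" for y by (simp add: g_def w_def sum_nonneg)
  have g_large: "K * \<tau> powr \<rho> \<le> g y" if y: "y \<in> large_blocks a i \<tau>" for y
  proof -
    obtain l j where l: "l \<le> i" and j: "j < 2 ^ i"
      and large: "\<tau> \<le> norm (\<Sum>n | n \<in> {1..2 ^ i} \<and> (n - 1) div 2 ^ l = j. weyl_term a y n)"
      using y unfolding large_blocks_def by blast
    define S where "S = (\<Sum>J\<in>P. norm (\<Sum>n\<in>{1..2 ^ i}. if (n - 1) div 2 ^ l \<in> J
        then weyl_term a y n else - weyl_term a y n) powr \<rho>)"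
    have "K * \<tau> powr \<rho> \<le> K * norm (\<Sum>n | n \<in> {1..2 ^ i} \<and> (n - 1) div 2 ^ l = j. weyl_term a y n) powr \<rho>"
      using large \<open>0 < \<tau>\<close> \<open>0 < \<rho>\<close> K(1) by (intro mult_left_mono powr_mono2) auto
    also have "\<dots> \<le> S"
      unfolding K_def P_def S_def
      using block_sum_le_sign_average[of "{1..2 ^ i}" "{..<2 ^ i}" j \<rho> "weyl_term a y"
          "\<lambda>n. (n - 1) div 2 ^ l"]
        j \<open>0 < \<rho>\<close> by simp
    also have "S = (\<Sum>J\<in>P. w l J y)"
      unfolding S_def w_def weyl_sum_eq_sum_weyl_term
      by (intro sum.cong refl arg_cong[where f = "\<lambda>z. norm z powr \<rho>"])
         (auto simp: c_def weyl_term_def)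
    also have "\<dots> \<le> g y"
      unfolding g_def using l
      by (intro member_le_sum[of l "{..i}" "\<lambda>l. \<Sum>J\<in>P. w l J y"]) (auto simp: w_def sum_nonneg)
    finally show ?thesis .
  qed
  have "0 < K * \<tau> powr \<rho>" using K \<open>0 < \<tau>\<close> by simp
  have "measure \<mu> (large_blocks a i \<tau>) \<le> measure \<mu> {y \<in> space \<mu>. K * \<tau> powr \<rho> \<le> g y}"
    using g_large g_int by (intro finite_measure_mono) (auto simp: sp)
  also have "\<dots> \<le> (LINT y|\<mu>. g y) / (K * \<tau> powr \<rho>)"
    using g_int \<open>0 < K * \<tau> powr \<rho>\<close>
      g_nonneg
    by (intro integral_Markov_inequality_measure[where A = "space \<mu>"]) auto
  also have "\<dots> \<le> ((real i + 1) * (2 * K) * B) / (K * \<tau> powr \<rho>)"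
    using g_le \<open>0 < K * \<tau> powr \<rho>\<close> by (intro divide_right_mono) auto
  also have "\<dots> = 2 * (real i + 1) * B / \<tau> powr \<rho>" using K by simp
  finally show ?thesis .
qed

section \<open>The dimension bound\<close>

lemma bij_betw_coord_no: "bij_betw coord_no (UNIV :: 'd::{finite,linorder} set) {1..CARD('d)}"
proof -
  have "coord_no j < coord_no k" if "j < k" for j k :: 'd
    unfolding coord_no_def using that by (intro psubset_card_mono) auto
  then have inj: "inj (coord_no :: 'd \<Rightarrow> nat)"
    by (intro injI) (metis less_irrefl linorder_neqE)
  have "range (coord_no :: 'd \<Rightarrow> nat) \<subseteq> {1..CARD('d)}"
    by (auto simp: coord_no_def card_gt_0_iff Suc_le_eq intro!: card_mono)
  then have "range (coord_no :: 'd \<Rightarrow> nat) = {1..CARD('d)}"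
    using card_image[OF inj] by (intro card_subset_eq) auto
  with inj show ?thesis by (simp add: bij_betw_def)
qed

text \<open>Coordinates numbered \<open>1\<close> to \<open>k\<close> contribute the exponents
  \<open>k, ..., 1\<close>, which add up to \<open>tri k\<close>; from number \<open>k + 1\<close>
  on the maximum is \<open>1\<close>.\<close>

lemma prod_max_1_powr:
  assumes "k < CARD('d::{finite,linorder})" "1 \<le> N"
  shows "(\<Prod>j\<in>(UNIV :: 'd set). max 1 (N powr (real k + 1 - real (coord_no j)))) = N powr tri k"
proof -
  have "(\<Prod>j\<in>(UNIV :: 'd set). max 1 (N powr (real k + 1 - real (coord_no j))))
      = (\<Prod>c\<in>{1..CARD('d)}. max 1 (N powr (real k + 1 - real c)))"
    by (rule prod.reindex_bij_betw[OF bij_betw_coord_no])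
  also have "\<dots> = (\<Prod>c\<in>{1..k}. max 1 (N powr (real k + 1 - real c)))"
  proof (rule prod.mono_neutral_right)
    show "\<forall>c\<in>{1..CARD('d)} - {1..k}. max 1 (N powr (real k + 1 - real c)) = 1"
    proof
      fix c assume "c \<in> {1..CARD('d)} - {1..k}"
      then have "N powr (real k + 1 - real c) \<le> N powr 0"
        using assms(2) by (intro powr_mono) auto
      then show "max 1 (N powr (real k + 1 - real c)) = 1" using assms(2) by simp
    qed
  qed (use assms(1) in auto)
  also have "\<dots> = (\<Prod>c\<in>{1..k}. N powr (real k + 1 - real c))"
  proof (rule prod.cong[OF refl])
    fix c assume "c \<in> {1..k}"
    then show "max 1 (N powr (real k + 1 - real c)) = N powr (real k + 1 - real c)"
      using assms(2) by (simp add: ge_one_powr_ge_zero)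
  qed
  also have "\<dots> = N powr (\<Sum>c\<in>{1..k}. real k + 1 - real c)"
    using assms(2) by (simp add: powr_sum)
  also have "(\<Sum>c\<in>{1..k}. real k + 1 - real c) = tri k"
  proof -
    have "(\<Sum>c\<in>{1..k}. real c) = tri k"
      by (induction k) (auto simp: tri_def field_simps)
    then show ?thesis by (simp add: sum_subtractf tri_def field_simps)
  qed
  finally show ?thesis .
qed

text \<open>The count at one scale is a product: the number of rectangles is at most the measure of
  \<open>G\<close> divided by \<open>f \<zeta>\<close>, and each doubled rectangle takes at most
  \<open>6 ^ CARD('d) * N powr tri k\<close> cubes.\<close>

lemma large_sums_scale_cover:
  fixes \<mu> :: "(real ^ 'd::{finite,linorder}) measure"
  assumes \<mu>: "torus_radon_measure \<mu>" and f: "\<And>\<zeta>. \<zeta> \<in> pos_vecs \<Longrightarrow> 0 < f \<zeta>"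
    and reg: "regular_measure f \<mu>" and "0 < \<rho>" "0 < \<epsilon>" and k: "k < CARD('d)"
    and \<delta>: "\<delta> = \<epsilon> / (\<rho> + 4)" and N: "N = (2 :: real) ^ i"
    and ev1: "4 * (real i + 1) \<le> N powr \<delta>"
    and ev2: "2 * pi * real CARD('d) \<le> N powr (\<epsilon> / 2)"
    and a: "\<And>n. n \<in> {1..2 ^ i} \<Longrightarrow> norm (a n) \<le> N powr (\<epsilon> / 4)"
    and mean: "\<And>b. (\<And>n. norm (b n) = norm (a n)) \<Longrightarrow>
           (LINT x:torus|\<mu>. norm (weyl_sum b x (2 ^ i)) powr \<rho>) \<le> N powr (\<theta> * \<rho> + \<delta>)"
  shows "\<exists>\<U>. finite \<U> \<and>
     real (card \<U>) \<le> 6 ^ CARD('d) * N powr (\<rho> * \<theta> - \<rho> * \<alpha> + \<epsilon> + tri k) * inverse (f (zeta_vec \<alpha> \<epsilon> i)) \<and>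
     {x \<in> spt \<mu>. \<exists>M\<le>2 ^ i. N powr \<alpha> / 2 \<le> norm (weyl_sum a x M)} \<subseteq> \<Union>\<U> \<and>
     (\<forall>U\<in>\<U>. bounded U \<and> diameter U \<le> real CARD('d) * N powr (\<alpha> - real k - 2 - \<epsilon>))"
proof -
  interpret finite_measure \<mu> using \<mu> by (simp add: torus_radon_measure_def)
  define E where "E = {x \<in> spt \<mu>. \<exists>M\<le>2 ^ i. N powr \<alpha> / 2 \<le> norm (weyl_sum a x M)}"
  define \<zeta> :: "real ^ 'd::{finite,linorder}" where "\<zeta> = zeta_vec \<alpha> \<epsilon> i"
  define G :: "(real ^ 'd::{finite,linorder}) set" where "G = large_blocks a i (N powr (\<alpha> - \<delta>))"
  have N1: "1 \<le> N" by (simp add: N)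
  \<comment> \<open>\<open>\<delta>\<close> is small enough for two purposes:
    \<open>\<delta> * (\<rho> + 2) \<le> \<epsilon>\<close> in the measure of \<open>G\<close>, and
    \<open>\<delta> \<le> \<epsilon> / 4\<close> in the perturbation of block sums.\<close>
  have \<delta>_bounds: "0 < \<delta>" "\<delta> \<le> \<epsilon> / 4" "\<delta> * (\<rho> + 4) = \<epsilon>"
    using \<open>0 < \<rho>\<close> \<open>0 < \<epsilon>\<close> by (simp_all add: \<delta> divide_le_eq)
  have \<zeta>: "\<zeta> $ j = N powr (\<alpha> - real (coord_no j) - 1 - \<epsilon>)" for j
    by (simp add: \<zeta>_def zeta_vec_def N)
  have \<zeta>_pos: "0 < \<zeta> $ j" for j using N1 by (simp add: \<zeta>)
  then have \<zeta>_pv: "\<zeta> \<in> pos_vecs" by (simp add: pos_vecs_def)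
  have sub: "rect x \<zeta> \<subseteq> G" if "x \<in> E" for x
  proof
    fix y assume y: "y \<in> rect x \<zeta>"
    obtain M where "M \<le> 2 ^ i" and M: "N powr \<alpha> / 2 \<le> norm (\<Sum>n=1..M. weyl_term a x n)"
      using \<open>x \<in> E\<close> by (auto simp: E_def weyl_sum_eq_sum_weyl_term)
    define X where "X l j = {n. n \<in> {1..2 ^ i} \<and> (n - 1) div 2 ^ l = j}" for l j :: nat
    obtain l j where l: "l \<le> i" and j: "j < 2 ^ i" and
      block: "norm (\<Sum>n=1..M. weyl_term a x n) \<le> (real i + 1) * norm (\<Sum>n\<in>X l j. weyl_term a x n)"
      using prefix_le_dyadic_block[OF \<open>M \<le> 2 ^ i\<close>, of "weyl_term a x"] unfolding X_def by blast
    \<comment> \<open>At \<open>x\<close> the block sum reaches twice the threshold of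
      \<open>G\<close>; the surplus is spent on moving from \<open>x\<close> to
      \<open>y\<close>.\<close>
    have "(real i + 1) * (2 * N powr (\<alpha> - \<delta>)) = 4 * (real i + 1) * N powr (\<alpha> - \<delta>) / 2"
      by simp
    also have "\<dots> \<le> N powr \<delta> * N powr (\<alpha> - \<delta>) / 2"
      using ev1 by (intro divide_right_mono mult_right_mono) auto
    also have "\<dots> = N powr \<alpha> / 2" by (simp flip: powr_add)
    also have "\<dots> \<le> (real i + 1) * norm (\<Sum>n\<in>X l j. weyl_term a x n)" using M block by linarith
    finally have x_block: "2 * N powr (\<alpha> - \<delta>) \<le> norm (\<Sum>n\<in>X l j. weyl_term a x n)"
      by (rule mult_left_le_imp_le) simp
    \<comment> \<open>The side lengths are made for this: \<open>\<zeta> $ j\<close> times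
      \<open>N\<close> to the power \<open>coord_no j\<close> is
      \<open>N powr (\<alpha> - 1 - \<epsilon>)\<close> for every \<open>j\<close>.\<close>
    have "norm ((\<Sum>n\<in>X l j. weyl_term a y n) - (\<Sum>n\<in>X l j. weyl_term a x n))
        \<le> real (2 ^ i) * N powr (\<epsilon> / 4) * (2 * pi * (real CARD('d) * N powr (\<alpha> - 1 - \<epsilon>)))"
    proof (rule weyl_term_sum_perturbation)
      fix j
      have "\<bar>y $ j - x $ j\<bar> * real (2 ^ i) ^ coord_no j \<le> \<zeta> $ j * real (2 ^ i) ^ coord_no j"
        using y by (intro mult_right_mono) (auto simp: rect_def abs_le_iff dest: spec[of _ j])
      also have "\<dots> = N powr (\<alpha> - real (coord_no j) - 1 - \<epsilon>) * N powr real (coord_no j)"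
        using N1 by (simp add: \<zeta> N powr_realpow)
      also have "\<dots> = N powr (\<alpha> - 1 - \<epsilon>)"
        unfolding powr_add[symmetric] by (simp add: algebra_simps)
      finally show "\<bar>y $ j - x $ j\<bar> * real (2 ^ i) ^ coord_no j \<le> N powr (\<alpha> - 1 - \<epsilon>)" .
    qed (use a in \<open>auto simp: X_def\<close>)
    also have "\<dots> = N powr 1 * N powr (\<epsilon> / 4) * ((2 * pi * real CARD('d)) * N powr (\<alpha> - 1 - \<epsilon>))"
      by (simp add: N)
    also have "\<dots> \<le> N powr 1 * N powr (\<epsilon> / 4) * (N powr (\<epsilon> / 2) * N powr (\<alpha> - 1 - \<epsilon>))"
      using ev2 by (intro mult_left_mono mult_right_mono) auto
    also have "\<dots> = N powr (\<alpha> - \<epsilon> / 4)"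
      unfolding powr_add[symmetric] by (simp add: algebra_simps)
    also have "\<dots> \<le> N powr (\<alpha> - \<delta>)" using N1 \<delta>_bounds by (intro powr_mono) auto
    finally have "norm ((\<Sum>n\<in>X l j. weyl_term a y n) - (\<Sum>n\<in>X l j. weyl_term a x n)) \<le> N powr (\<alpha> - \<delta>)" .
    then have "N powr (\<alpha> - \<delta>) \<le> norm (\<Sum>n\<in>X l j. weyl_term a y n)"
      using x_block norm_triangle_ineq2[of "\<Sum>n\<in>X l j. weyl_term a x n" "\<Sum>n\<in>X l j. weyl_term a y n"]
      by (simp add: norm_minus_commute)
    then show "y \<in> G" unfolding G_def large_blocks_def X_def using l j by blast
  qed
  have "measure \<mu> G \<le> 2 * (real i + 1) * N powr (\<theta> * \<rho> + \<delta>) / (N powr (\<alpha> - \<delta>)) powr \<rho>"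
    unfolding G_def using N1 \<open>0 < \<rho>\<close> mean by (intro measure_large_blocks_le \<mu>) auto
  also have "\<dots> \<le> N powr \<delta> * N powr (\<theta> * \<rho> + \<delta>) / (N powr (\<alpha> - \<delta>)) powr \<rho>"
    using ev1 by (intro divide_right_mono mult_right_mono) auto
  \<comment> \<open>One \<open>\<delta>\<close> pays for \<open>i + 1\<close>, one comes from the
    mean value bound, and \<open>\<delta> * \<rho>\<close> from the lowered threshold.\<close>
  also have "\<dots> = N powr (\<delta> + (\<theta> * \<rho> + \<delta>) - (\<alpha> - \<delta>) * \<rho>)"
    by (simp only: powr_powr powr_add[symmetric] powr_diff[symmetric])
  also have "\<dots> \<le> N powr (\<rho> * \<theta> - \<rho> * \<alpha> + \<epsilon>)"
    using N1 \<delta>_bounds by (intro powr_mono) (auto simp: algebra_simps)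
  finally have G_le: "measure \<mu> G \<le> N powr (\<rho> * \<theta> - \<rho> * \<alpha> + \<epsilon>)" .
  obtain F where F: "finite F" "real (card F) \<le> measure \<mu> G / f \<zeta>"
    "E \<subseteq> (\<Union>x\<in>F. {y. \<forall>j. \<bar>y $ j - x $ j\<bar> < 2 * \<zeta> $ j})"
  proof (rule finite_cover_by_doubled_rects)
    show "finite_measure \<mu>" by unfold_locales
    show "sets \<mu> = sets borel" using \<mu> by (simp add: torus_radon_measure_def)
    show "G \<in> sets borel" unfolding G_def by (rule large_blocks_borel)
    show "f \<zeta> \<le> measure \<mu> (rect x \<zeta>)" if "x \<in> E" for x
      using that reg \<zeta>_pv by (auto simp: E_def regular_measure_def)
  qed (use sub f \<zeta>_pv \<zeta>_pos in auto)
  \<comment> \<open>This is \<open>\<zeta> $ j\<close> for the coordinate with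
    \<open>coord_no j = k + 1\<close>.\<close>
  define h where "h = N powr (\<alpha> - real k - 2 - \<epsilon>)"
  have h: "0 < h" using N1 by (simp add: h_def)
  define good where "good x \<U> \<longleftrightarrow> finite \<U> \<and> {y. \<forall>j. \<bar>y $ j - x $ j\<bar> < 2 * \<zeta> $ j} \<subseteq> \<Union>\<U> \<and>
    real (card \<U>) \<le> 6 ^ CARD('d) * (\<Prod>j\<in>UNIV. max 1 (\<zeta> $ j / h)) \<and>
    (\<forall>U\<in>\<U>. bounded U \<and> diameter U \<le> real CARD('d) * h)" for x \<U>
  have "\<exists>\<U>. good x \<U>" for x
    unfolding good_def by (rule box_cover_by_cubes[where x = x and \<zeta> = \<zeta>, OF h \<zeta>_pos]) blast
  then obtain \<U> where "\<And>x. good x (\<U> x)" by metis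
  note \<U> = this[unfolded good_def]
  have "\<zeta> $ j / h = N powr (real k + 1 - real (coord_no j))" for j
    unfolding \<zeta> h_def powr_diff[symmetric] by (simp add: algebra_simps)
  then have prod: "(\<Prod>j\<in>UNIV. max 1 (\<zeta> $ j / h)) = N powr tri k"
    using prod_max_1_powr[OF k N1] by simp
  have "real (card (\<Union>x\<in>F. \<U> x)) \<le> real (\<Sum>x\<in>F. card (\<U> x))"
    using card_UN_le[OF F(1)] by (simp only: of_nat_le_iff)
  also have "\<dots> \<le> (\<Sum>x\<in>F. 6 ^ CARD('d) * N powr tri k)"
    unfolding of_nat_sum using \<U> prod by (intro sum_mono) auto
  also have "\<dots> = real (card F) * (6 ^ CARD('d) * N powr tri k)" by simp
  also have "\<dots> \<le> (N powr (\<rho> * \<theta> - \<rho> * \<alpha> + \<epsilon>) / f \<zeta>) * (6 ^ CARD('d) * N powr tri k)"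
    using f[OF \<zeta>_pv]
    by (intro mult_right_mono order_trans[OF F(2)] divide_right_mono G_le) auto
  also have "\<dots> = 6 ^ CARD('d) * N powr (\<rho> * \<theta> - \<rho> * \<alpha> + \<epsilon> + tri k) * inverse (f \<zeta>)"
    unfolding powr_add[of N _ "tri k"] divide_inverse by (simp only: mult_ac)
  finally have card: "real (card (\<Union>x\<in>F. \<U> x))
    \<le> 6 ^ CARD('d) * N powr (\<rho> * \<theta> - \<rho> * \<alpha> + \<epsilon> + tri k) * inverse (f \<zeta>)" .
  have "E \<subseteq> \<Union>(\<Union>x\<in>F. \<U> x)"
  proof
    fix y assume "y \<in> E"
    then obtain x where "x \<in> F" "y \<in> {y. \<forall>j. \<bar>y $ j - x $ j\<bar> < 2 * \<zeta> $ j}" using F(3) by blast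
    then show "y \<in> \<Union>(\<Union>x\<in>F. \<U> x)" using \<U>[of x] by blast
  qed
  then show ?thesis
    using F(1) \<U> card unfolding E_def \<zeta>_def h_def
    by (intro exI[of _ "\<Union>x\<in>F. \<U> x"]) auto
qed

section \<open>From one scale to the dimension\<close>

text \<open>A large sum of length \<open>M\<close> is seen at the next power of two above
  \<open>M\<close>. That power is at most \<open>2 * M\<close>, so the threshold changes by a factor
  of at most \<open>2 powr \<alpha> \<le> 2\<close>.\<close>

lemma large_sums_subset:
  assumes "0 \<le> \<alpha>" "\<alpha> \<le> 1"
  shows "large_sums a \<alpha> \<inter> S
    \<subseteq> (\<Union>i\<in>{m..}. {x \<in> S. \<exists>M\<le>2 ^ i. (2 ^ i) powr \<alpha> / 2 \<le> norm (weyl_sum a x M)})"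
proof
  fix x assume x: "x \<in> large_sums a \<alpha> \<inter> S"
  then have "infinite {N. real N powr \<alpha> \<le> norm (weyl_sum a x N)}" by (simp add: large_sums_def)
  then obtain M where M: "2 ^ m \<le> M" "real M powr \<alpha> \<le> norm (weyl_sum a x M)"
    unfolding infinite_nat_iff_unbounded_le by blast
  have "0 < M" by (rule less_le_trans[OF _ M(1)]) simp
  then obtain n where n: "2 ^ n \<le> M" "M < 2 ^ (n + 1)"
    using ex_power_ivl1[of 2 M] by auto
  have "2 ^ m < (2 :: nat) ^ (n + 1)" using M(1) n(2) by linarith
  then have "m \<le> Suc n" using power_less_imp_less_exp[of "2 :: nat" m "n + 1"] by simp
  have "(2 ^ Suc n) powr \<alpha> / 2 \<le> (2 ^ Suc n) powr \<alpha> / 2 powr \<alpha>"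
    using assms powr_mono[of \<alpha> 1 2] by (intro divide_left_mono) auto
  also have "\<dots> = (2 ^ n) powr \<alpha>" by (simp add: powr_mult)
  also have "\<dots> \<le> real M powr \<alpha>"
    using of_nat_mono[OF n(1), where 'a = real] \<open>0 \<le> \<alpha>\<close> by (intro powr_mono2) auto
  finally have "(2 ^ Suc n) powr \<alpha> / 2 \<le> norm (weyl_sum a x M)" using M(2) by linarith
  then show "x \<in> (\<Union>i\<in>{m..}. {x \<in> S. \<exists>M\<le>2 ^ i. (2 ^ i) powr \<alpha> / 2 \<le> norm (weyl_sum a x M)})"
    using x n(2) \<open>m \<le> Suc n\<close> by (intro UN_I[of "Suc n"]) (auto intro!: exI[of _ M])
qed

text \<open>The cover at scale \<open>i\<close> costs at most \<open>b i * r i powr t\<close>, which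
  is bounded by a constant times the term of the given series.\<close>

lemma hausdorff_measure_large_sums_eq_0:
  fixes \<mu> :: "(real ^ 'd::{finite,linorder}) measure"
  assumes \<alpha>: "0 < \<alpha>" "\<alpha> < 1"
    and \<mu>: "torus_radon_measure \<mu>" and f: "\<And>\<zeta>. \<zeta> \<in> pos_vecs \<Longrightarrow> 0 < f \<zeta>"
    and reg: "regular_measure f \<mu>" and "0 < \<rho>" "0 < \<epsilon>" "0 < t" and k: "k < CARD('d)"
    and mean: "mean_value_bound \<mu> \<rho> \<theta>" and a: "subpolynomial a"
    and summ: "(\<lambda>i. (2 ^ i) powr (\<rho> * \<theta> - \<rho> * \<alpha> + tri k + t * (\<alpha> - real k - 2) + \<epsilon>)
               * inverse (f (zeta_vec \<alpha> \<epsilon> i))) summable_on {1::nat..}"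
  shows "hausdorff_measure t (large_sums a \<alpha> \<inter> spt \<mu>) = 0"
proof -
  define T where "T i = (2 ^ i) powr (\<rho> * \<theta> - \<rho> * \<alpha> + tri k + t * (\<alpha> - real k - 2) + \<epsilon>)
               * inverse (f (zeta_vec \<alpha> \<epsilon> i))" for i
  define b where "b i = 6 ^ CARD('d) * (2 ^ i) powr (\<rho> * \<theta> - \<rho> * \<alpha> + \<epsilon> + tri k)
               * inverse (f (zeta_vec \<alpha> \<epsilon> i))" for i
  define r where "r i = real CARD('d) * (2 ^ i) powr (\<alpha> - real k - 2 - \<epsilon>)" for i
  define \<delta> where "\<delta> = \<epsilon> / (\<rho> + 4)"
  have "0 < \<delta>" using \<open>0 < \<rho>\<close> \<open>0 < \<epsilon>\<close> by (simp add: \<delta>_def)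
  have f_pos: "0 < f (zeta_vec \<alpha> \<epsilon> i)" for i
    by (intro f) (simp add: pos_vecs_def zeta_vec_def)
  have T_nonneg: "0 \<le> T i" for i using f_pos[of i] by (simp add: T_def)
  \<comment> \<open>The given series starts at \<open>1\<close>; adding the index \<open>0\<close>
    makes it an ordinary series over the naturals.\<close>
  have "T summable_on ({0} \<union> {1..})"
    using summ unfolding T_def[symmetric] by (intro summable_on_Un_disjoint) auto
  also have "{0} \<union> {1..} = (UNIV :: nat set)" by auto
  finally have "summable T" using T_nonneg by (simp add: summable_on_UNIV_nonneg_real_iff)
  show ?thesis
  proof (rule hausdorff_measure_eq_0I)
    show "large_sums a \<alpha> \<inter> spt \<mu> \<subseteq> (\<Union>i\<in>{m..}. {x \<in> spt \<mu>.
        \<exists>M\<le>2 ^ i. (2 ^ i) powr \<alpha> / 2 \<le> norm (weyl_sum a x M)})" for m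
      using \<alpha> by (intro large_sums_subset) auto
    have pow: "strict_mono (\<lambda>i. 2 ^ i :: nat)" by (simp add: strict_mono_def)
    have "\<forall>\<^sub>F i in sequentially. 4 * (real i + 1) \<le> (2 ^ i) powr \<delta>"
      by (rule eventually_linear_le_powr[OF \<open>0 < \<delta>\<close>])
    \<comment> \<open>The factor \<open>real i + 1 \<ge> 1\<close> is inserted so that the linear
      growth lemma also yields the bound for the constant.\<close>
    moreover have "\<forall>\<^sub>F i in sequentially. 2 * pi * real CARD('d) * (real i + 1) \<le> (2 ^ i) powr (\<epsilon> / 2)"
      using \<open>0 < \<epsilon>\<close> by (intro eventually_linear_le_powr) simp
    moreover have "\<forall>\<^sub>F i in sequentially. \<forall>n\<in>{1..2 ^ i}. norm (a n) \<le> real (2 ^ i) powr (\<epsilon> / 4)"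
      using \<open>0 < \<epsilon>\<close> by (intro eventually_subseq[OF pow subpolynomial_imp_max_le] a) simp
    moreover have "\<forall>\<^sub>F i in sequentially. \<forall>b. (\<forall>n\<in>{1..2 ^ i}. norm (b n) \<le> norm (a n)) \<longrightarrow>
        (LINT x:torus|\<mu>. norm (weyl_sum b x (2 ^ i)) powr \<rho>) \<le> real (2 ^ i) powr (\<theta> * \<rho> + \<delta>)"
      by (rule eventually_subseq[OF pow mean_value_bound_uniform[OF mean a \<open>0 < \<delta>\<close>]])
    ultimately show "\<forall>\<^sub>F i in sequentially. \<exists>\<U>. finite \<U> \<and> real (card \<U>) \<le> b i \<and>
        {x \<in> spt \<mu>. \<exists>M\<le>2 ^ i. (2 ^ i) powr \<alpha> / 2 \<le> norm (weyl_sum a x M)} \<subseteq> \<Union>\<U> \<and>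
        (\<forall>U\<in>\<U>. bounded U \<and> diameter U \<le> r i)"
    proof eventually_elim
      case (elim i)
      have "2 * pi * real CARD('d) * 1 \<le> 2 * pi * real CARD('d) * (real i + 1)"
        by (intro mult_left_mono) auto
      then have "2 * pi * real CARD('d) \<le> (2 ^ i) powr (\<epsilon> / 2)" using elim(2) by linarith
      then show ?case
        unfolding b_def r_def using elim(1,3,4) \<open>0 < \<rho>\<close> \<open>0 < \<epsilon>\<close>
        by (intro large_sums_scale_cover[OF \<mu> f reg _ _ k \<delta>_def refl]) auto
    qed
    show "0 \<le> r i" for i by (simp add: r_def)
    show "0 \<le> b i" for i using f_pos[of i] by (simp add: b_def)
    show "0 < t" by fact
    have lim: "filterlim (\<lambda>i. (2 :: real) ^ i) at_top sequentially"
      using filterlim_compose[OF filterlim_real_sequentially filterlim_subseq[OF pow]] by simp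
    have "(\<lambda>i. (2 ^ i) powr (\<alpha> - real k - 2 - \<epsilon>)) \<longlonglongrightarrow> 0"
      using \<alpha> \<open>0 < \<epsilon>\<close> by (intro tendsto_neg_powr lim) auto
    then show "r \<longlonglongrightarrow> 0" unfolding r_def by (rule tendsto_mult_right_zero)
    show "summable (\<lambda>i. b i * r i powr t)"
    proof (rule summable_comparison_test')
      show "summable (\<lambda>i. (6 ^ CARD('d) * real CARD('d) powr t) * T i)"
        using \<open>summable T\<close> by (rule summable_mult)
      fix i :: nat
      define N where "N = (2 :: real) ^ i"
      have N1: "1 \<le> N" by (simp add: N_def)
      have "b i * r i powr t = (6 ^ CARD('d) * real CARD('d) powr t) *
          (N powr (\<rho> * \<theta> - \<rho> * \<alpha> + \<epsilon> + tri k + (\<alpha> - real k - 2 - \<epsilon>) * t) * inverse (f (zeta_vec \<alpha> \<epsilon> i)))"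
        using N1 by (simp add: b_def r_def N_def[symmetric] powr_mult powr_powr powr_add[of N _ "_ * t"])
      \<comment> \<open>The \<open>\<epsilon>\<close> in the diameter leaves a factor
        \<open>N powr (- \<epsilon> * t) \<le> 1\<close>, which is dropped.\<close>
      also have "\<dots> \<le> (6 ^ CARD('d) * real CARD('d) powr t) * T i"
        unfolding T_def N_def[symmetric] using N1 f_pos[of i] \<open>0 < \<epsilon>\<close> \<open>0 < t\<close>
        by (intro mult_left_mono mult_right_mono powr_mono) (auto simp: algebra_simps)
      finally show "norm (b i * r i powr t) \<le> (6 ^ CARD('d) * real CARD('d) powr t) * T i"
        using f_pos[of i] by (simp add: b_def)
    qed
  qed
qed

theorem theorem2p9:
  assumes "CARD('d::{finite,linorder}) \<ge> 2"
  shows "\<exists>c>0. \<forall>(\<alpha>::real) (\<mu> :: (real ^ 'd::{finite,linorder}) measure) (f :: real ^ 'd::{finite,linorder} \<Rightarrow> real)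
           (\<rho>::real) (\<theta>::real) (a :: nat \<Rightarrow> complex).
     0 < \<alpha> \<and> \<alpha> < 1 \<and>
     torus_radon_measure \<mu> \<and> (\<forall>\<zeta>\<in>pos_vecs. 0 < f \<zeta>) \<and> regular_measure f \<mu> \<and>
     0 < \<rho> \<and> 0 < \<theta> \<and> \<theta> < 1 \<and> mean_value_bound \<mu> \<rho> \<theta> \<and>
     subpolynomial a
     \<longrightarrow> hausdorff_dim (large_sums a \<alpha> \<inter> spt \<mu>) \<le> dim_bound c \<rho> \<theta> f \<alpha>"
proof (intro exI[of _ 1] conjI allI impI)
  fix \<alpha> \<rho> \<theta> :: real and \<mu> :: "(real ^ 'd::{finite,linorder}) measure"
    and f :: "real ^ 'd::{finite,linorder} \<Rightarrow> real" and a :: "nat \<Rightarrow> complex"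
  assume *: "0 < \<alpha> \<and> \<alpha> < 1 \<and>
     torus_radon_measure \<mu> \<and> (\<forall>\<zeta>\<in>pos_vecs. 0 < f \<zeta>) \<and> regular_measure f \<mu> \<and>
     0 < \<rho> \<and> 0 < \<theta> \<and> \<theta> < 1 \<and> mean_value_bound \<mu> \<rho> \<theta> \<and>
     subpolynomial a"
  show "hausdorff_dim (large_sums a \<alpha> \<inter> spt \<mu>) \<le> dim_bound 1 \<rho> \<theta> f \<alpha>"
    unfolding hausdorff_dim_def dim_bound_def
  proof (intro Inf_superset_mono image_mono subsetI)
    fix t assume "t \<in> {t. t > 0 \<and> (\<exists>\<epsilon>>0. \<exists>k\<in>{0..CARD('d) - 1}.
        (\<lambda>i. (2 ^ i) powr (\<rho> * \<theta> - \<rho> * \<alpha> + tri k + t * (\<alpha> - real k - 2) + 1 * \<epsilon>)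
               * inverse (f (zeta_vec \<alpha> \<epsilon> i))) summable_on {1::nat..})}"
    then obtain \<epsilon> k where "0 < t" "0 < \<epsilon>" and "k \<le> CARD('d) - 1" and
      summ: "(\<lambda>i. (2 ^ i) powr (\<rho> * \<theta> - \<rho> * \<alpha> + tri k + t * (\<alpha> - real k - 2) + \<epsilon>)
               * inverse (f (zeta_vec \<alpha> \<epsilon> i))) summable_on {1::nat..}" by auto
    have "k < CARD('d)" using \<open>k \<le> CARD('d) - 1\<close> assms by linarith
    have "hausdorff_measure t (large_sums a \<alpha> \<inter> spt \<mu>) = 0"
      by (rule hausdorff_measure_large_sums_eq_0[where f = f and \<rho> = \<rho> and \<theta> = \<theta> and k = k and \<epsilon> = \<epsilon>])
         (use * \<open>0 < t\<close> \<open>0 < \<epsilon>\<close> \<open>k < CARD('d)\<close> summ in auto)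
    then show "t \<in> {s. s > 0 \<and> hausdorff_measure s (large_sums a \<alpha> \<inter> spt \<mu>) = 0}"
      using \<open>0 < t\<close> by simp
  qed
qed simp

end
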